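(* Let $g(\gamma,x,y)=\gamma-x^2-\gamma y+\frac y2+xy$. The minimum of $g$ over all real $(\gamma,x,y)$ satisfying (1) $1\le\gamma\le\frac94$; (2) $0\le y\le x\le\min\left(\frac\gamma2,1\right)$; (3) $x+y\le\gamma-\frac12$; (4) $x+y\le\frac{1+\gamma}{2}$ equals $\frac34$, and it is attained at exactly two points: $(\gamma,x,y)=(1,\frac12,0)$ and $(\gamma,x,y)=(2,1,\frac12)$. *)

theory Defs
  imports Complex_Main
begin

definition g :: "real \<times> real \<times> real \<Rightarrow> real" where
  "g = (\<lambda>(\<gamma>, x, y). \<gamma> - x\<^sup>2 - \<gamma> * y + y / 2 + x * y)"

definition feasible :: "(real \<times> real \<times> real) set" where
  "feasible = {(\<gamma>, x, y).
     1 \<le> \<gamma> \<and> \<gamma> \<le> 9 / 4 \<and>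
     0 \<le> y \<and> y \<le> x \<and> x \<le> min (\<gamma> / 2) 1 \<and>
     x + y \<le> \<gamma> - 1 / 2 \<and>
     x + y \<le> (1 + \<gamma>) / 2}"

end

(* On the feasible set y < 1, so g is strictly increasing in \<gamma> and \<gamma> may be replaced by one of its
   lower bounds: 1 if x \<le> 1/2, 2x if x \<ge> 1/2 and x + y \<le> 3/2, and 2(x + y) - 1 if x + y \<ge> 3/2.
   In each case the resulting polynomial minus 3/4 splits into products of nonnegative factors,
   whose zeros give the two minimizers. *)
theory Submission
  imports Defs
begin

lemma g_minus_lower_bound:
  "g (\<gamma>, x, y) - 3 / 4 = (\<gamma> - 1) * (1 - y) + (1 / 2 - x) * (1 / 2 + x - y)"
  "g (\<gamma>, x, y) - 3 / 4 = (\<gamma> - 2 * x) * (1 - y) + (x - 1 / 2) * (3 / 2 - (x + y))"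
  "g (\<gamma>, x, y) - 3 / 4 = (\<gamma> - (2 * (x + y) - 1)) * (1 - y)
     + ((1 - x) * (x + y - 1) + (2 * y - 1) * (3 / 4 - y))"
  by (simp_all add: g_def field_simps power2_eq_square)

text \<open>The bound 13/8 comes from 2(x + y) - 1 \<le> \<gamma> \<le> 9/4. Here y \<ge> 1/2, and
  the second product changes sign at y = 3/4; beyond that the first product has to outweigh
  it.\<close>

lemma residual_sum_ge:
  fixes x y :: real
  assumes "y \<le> x" "x \<le> 1" "3 / 2 \<le> x + y" "x + y \<le> 13 / 8"
  shows "0 \<le> (1 - x) * (x + y - 1) + (2 * y - 1) * (3 / 4 - y)"
    and "(1 - x) * (x + y - 1) + (2 * y - 1) * (3 / 4 - y) = 0 \<Longrightarrow> x = 1 \<and> y = 1 / 2"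
proof -
  let ?F = "(1 - x) * (x + y - 1) + (2 * y - 1) * (3 / 4 - y)"
  have "0 \<le> ?F \<and> (?F = 0 \<longrightarrow> x = 1 \<and> y = 1 / 2)"
  proof (cases "y \<le> 3 / 4")
    case True
    have "0 \<le> (1 - x) * (x + y - 1)" "0 \<le> (2 * y - 1) * (3 / 4 - y)"
      using assms True by auto
    \<comment> \<open>Since x + y > 1, the first product forces x = 1. Then y = 3/4 would give x + y
      = 7/4 > 13/8, leaving only y = 1/2.\<close>
    moreover have "x = 1 \<and> y = 1 / 2" if "(1 - x) * (x + y - 1) = 0" "(2 * y - 1) * (3 / 4 - y) = 0"
      using that assms by auto
    ultimately show ?thesis by (smt (verit))
  next
    case False
    \<comment> \<open>Compare factor by factor: y - 3/4 < 1 - x because x + y \<le> 13/8 < 7/4, and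
      2y - 1 \<le> x + y - 1 because y \<le> x.\<close>
    have "(y - 3 / 4) * (2 * y - 1) < (1 - x) * (x + y - 1)"
      using assms False by (intro mult_less_le_imp_less) auto
    then show ?thesis by (auto simp: algebra_simps)
  qed
  then show "0 \<le> ?F" and "?F = 0 \<Longrightarrow> x = 1 \<and> y = 1 / 2" by auto
qed

text \<open>Handles equality: with b = 1 - y > 0, the value 3/4 forces \<gamma> to equal its lower
  bound and the residual c to vanish.\<close>

lemma add_mult_eq_0D:
  fixes a b c :: real
  assumes "0 \<le> a" "0 < b" "0 \<le> c" "a * b + c = 0"
  shows "a = 0" "c = 0"
  using assms by (auto simp: add_nonneg_eq_0_iff)

lemma feasible_g_ge:
  assumes "(\<gamma>, x, y) \<in> feasible"
  shows "3 / 4 \<le> g (\<gamma>, x, y)"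
    and "g (\<gamma>, x, y) = 3 / 4 \<Longrightarrow> (\<gamma>, x, y) \<in> {(1, 1 / 2, 0), (2, 1, 1 / 2)}"
proof -
  have f: "1 \<le> \<gamma>" "\<gamma> \<le> 9 / 4" "0 \<le> y" "y \<le> x" "2 * x \<le> \<gamma>" "x \<le> 1"
      "x + y \<le> \<gamma> - 1 / 2" "2 * (x + y) - 1 \<le> \<gamma>"
    using assms by (auto simp: feasible_def)
  \<comment> \<open>From y \<le> x and the last constraint, 2y \<le> x + y \<le> 13/8.\<close>
  then have y: "0 < 1 - y" by linarith
  \<comment> \<open>The breakpoints 1/2 and 3/2 are the zeros of the factors of the second residual,
    (x - 1/2)(3/2 - (x + y)).\<close>
  consider "x \<le> 1 / 2" | "1 / 2 < x" "x + y < 3 / 2" | "3 / 2 \<le> x + y" by linarith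
  then have "3 / 4 \<le> g (\<gamma>, x, y) \<and>
      (g (\<gamma>, x, y) = 3 / 4 \<longrightarrow> (\<gamma>, x, y) \<in> {(1, 1 / 2, 0), (2, 1, 1 / 2)})"
  proof cases
    case 1
    have a: "0 \<le> \<gamma> - 1" and c: "0 \<le> (1 / 2 - x) * (1 / 2 + x - y)" using f 1 by auto
    have "0 \<le> (\<gamma> - 1) * (1 - y)" using a y by auto
    moreover have "\<gamma> = 1 \<and> x = 1 / 2 \<and> y = 0" if "g (\<gamma>, x, y) = 3 / 4"
    proof -
      have "(\<gamma> - 1) * (1 - y) + (1 / 2 - x) * (1 / 2 + x - y) = 0"
        using that g_minus_lower_bound(1)[of \<gamma> x y] by simp
      \<comment> \<open>The factor 1/2 + x - y is positive, so x = 1/2; with \<gamma> = 1, the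
        constraint x + y \<le> \<gamma> - 1/2 then forces y = 0.\<close>
      from add_mult_eq_0D[OF a y c this] f show ?thesis by auto
    qed
    ultimately show ?thesis using c g_minus_lower_bound(1)[of \<gamma> x y] by auto
  next
    case 2
    \<comment> \<open>The residual is strictly positive, so this case contains no minimizer.\<close>
    have "0 \<le> (\<gamma> - 2 * x) * (1 - y)" "0 < (x - 1 / 2) * (3 / 2 - (x + y))" using f y 2 by auto
    then show ?thesis using g_minus_lower_bound(2)[of \<gamma> x y] by auto
  next
    case 3
    have s: "x + y \<le> 13 / 8" using f(2,8) by simp
    note F = residual_sum_ge[OF f(4) f(6) 3 s]
    have a: "0 \<le> \<gamma> - (2 * (x + y) - 1)" using f by simp
    have "0 \<le> (\<gamma> - (2 * (x + y) - 1)) * (1 - y)" using a y by (intro mult_nonneg_nonneg) auto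
    moreover have "\<gamma> = 2 \<and> x = 1 \<and> y = 1 / 2" if "g (\<gamma>, x, y) = 3 / 4"
    proof -
      have "(\<gamma> - (2 * (x + y) - 1)) * (1 - y)
          + ((1 - x) * (x + y - 1) + (2 * y - 1) * (3 / 4 - y)) = 0"
        using that g_minus_lower_bound(3)[of \<gamma> x y] by simp
      from add_mult_eq_0D[OF a y F(1) this] F(2) show ?thesis by auto
    qed
    ultimately show ?thesis using F(1) g_minus_lower_bound(3)[of \<gamma> x y] by auto
  qed
  then show "3 / 4 \<le> g (\<gamma>, x, y)"
    and "g (\<gamma>, x, y) = 3 / 4 \<Longrightarrow> (\<gamma>, x, y) \<in> {(1, 1 / 2, 0), (2, 1, 1 / 2)}" by auto
qed

theorem theorem5:
  shows "3 / 4 \<in> g ` feasible \<and> (\<forall>v \<in> g ` feasible. 3 / 4 \<le> v) \<and>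
    {p. is_arg_min g (\<lambda>p. p \<in> feasible) p} = {(1, 1 / 2, 0), (2, 1, 1 / 2)}"
proof -
  have 1: "(1, 1 / 2, 0) \<in> feasible" "g (1, 1 / 2, 0) = 3 / 4"
    and 2: "(2, 1, 1 / 2) \<in> feasible" "g (2, 1, 1 / 2) = 3 / 4"
    by (simp_all add: feasible_def g_def power2_eq_square)
  have ge: "3 / 4 \<le> g p" if "p \<in> feasible" for p
    using feasible_g_ge(1) that by (cases p) auto
  have eq: "p \<in> {(1, 1 / 2, 0), (2, 1, 1 / 2)}" if "p \<in> feasible" "g p = 3 / 4" for p
    using feasible_g_ge(2) that by (cases p) blast
  \<comment> \<open>The bound 3/4 is attained at the first point, so minimizing means having value
    exactly 3/4.\<close>
  have "is_arg_min g (\<lambda>p. p \<in> feasible) p \<longleftrightarrow> p \<in> feasible \<and> g p = 3 / 4" for p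
    using 1 ge[of p] ge unfolding is_arg_min_linorder by (metis order.antisym)
  then have "{p. is_arg_min g (\<lambda>p. p \<in> feasible) p} = {(1, 1 / 2, 0), (2, 1, 1 / 2)}"
    using 1 2 eq by blast
  moreover have "3 / 4 \<in> g ` feasible" using 1 by force
  ultimately show ?thesis using ge by blast
qed

end
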